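(* Suppose that $\alpha\in\Omega$ is a maximal sequence in $\Omega$, that $\Omega'=\Omega\setminus\{\alpha\}$ (satisfying condition C1), and that $C'$ is a connected component of $\Gamma(\Omega',q)$. Then $s=|\mathbb{L}(C')|$ divides $q$, and there exist maps $f:V(C')\to\mathbb{F}_q$, $g:\mathbb{L}(C')\to\mathbb{F}_q$ and an additive subgroup $G$ of $\mathbb{F}_q$ of order $t=q/s$ such that, for any $C\in\mathbb{L}(C')$ and $u'\in V(C')$, $$\rho(u',C)=\begin{cases}f(u')+g(C)+G,&\text{if }u'\in L(\Omega'),\\ f(u')-g(C)+G,&\text{if }u'\in R(\Omega'),\end{cases}$$ where $\{g(C):C\in\mathbb{L}(C')\}$ is a set of representatives of the cosets of $G$ in $\mathbb{F}_q$, i.e. the cosets $g(C)+G$, $C\in\mathbb{L}(C')$, are distinct and their union is $\mathbb{F}_q$. Furthermore, if $C'$ contains the all-zero vertices of $\Gamma(\Omega',q)$, then $t=|G|=p^{mn}$ for some integer $m$ with $0\le m\le\log_{p^n}q$, where $p$ is the characteristic of $\mathbb{F}_q$ and $n>0$ is the smallest integer such that $q-1$ divides $(p^n-1)\gcd(q-1,\,w(\alpha)+1,\,|\alpha|-w(\alpha)+1)$.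
   Context: Let $q$ be a prime power and $\mathbb{F}_q$ the field with $q$ elements. $\{0,1\}^*$ is the set of finite binary sequences, $\eta$ the null sequence; juxtaposition is concatenation; $|\alpha|$ is the length of $\alpha$ and $w(\alpha)$ the number of its nonzero bits. $\Omega\subset\{0,1\}^*$ is a finite set satisfying condition C1: $\eta\in\Omega$, and for any $\alpha\in\Omega\setminus\{\eta\}$ the sequence obtained by deleting the last bit of $\alpha$ is in $\Omega$. $L(\Omega)$ and $R(\Omega)$ are two disjoint copies of $\mathbb{F}_q^{|\Omega|+1}$; their vectors are written $[l]$ and $\langle r\rangle$ respectively, with entries indexed by $\Omega\cup\{*\}$, where $*\notin\Omega$ is an extra symbol. $\Gamma(\Omega,q)$ is the bipartite graph with vertex set $L(\Omega)\cup R(\Omega)$ in which $[l]\in L(\Omega)$ and $\langle r\rangle\in R(\Omega)$ are adjacent if and only if $l_\eta+r_\eta=l_*r_*$, $l_{\alpha0}+r_{\alpha0}=r_*l_\alpha$ for all $\alpha0\in\Omega$, and $l_{\beta1}+r_{\beta1}=l_*r_\beta$ for all $\beta1\in\Omega$ (here $\alpha,\beta\in\{0,1\}^*$). The same definitions apply to $\Omega'$. A sequence $\alpha\in\Omega$ is maximal in $\Omega$ if $\{\alpha0,\alpha1\}\cap\Omega=\emptyset$. $\Pi_{\Omega/\Omega'}$ is the natural projection from $\Gamma(\Omega,q)$ to $\Gamma(\Omega',q)$, keeping only the entries indexed by $\Omega'\cup\{*\}$ (it maps each component of $\Gamma(\Omega,q)$ onto a component of $\Gamma(\Omega',q)$).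 For a component $C'$ of $\Gamma(\Omega',q)$, $\mathbb{L}(C')$ is the set of components $C$ of $\Gamma(\Omega,q)$ with $\Pi_{\Omega/\Omega'}(C)=C'$. For a component $C$ of $\Gamma(\Omega,q)$ and $u\in V(\Pi_{\Omega/\Omega'}(C))$, $\rho(u,C)\subset\mathbb{F}_q$ is the set of the entries indexed by $\alpha$ of the vertices $v\in V(C)$ with $\Pi_{\Omega/\Omega'}(v)=u$. The all-zero vertices of $\Gamma(\Omega',q)$ are the zero vectors of $L(\Omega')$ and $R(\Omega')$ (which are adjacent). *)

theory Defs
  imports
    Complex_Main
    "HOL-Library.Cardinality"
    "HOL-Library.FuncSet"
    "HOL-Library.Set_Algebras"
    "HOL-Computational_Algebra.Primes"
    "Graph_Theory.Digraph_Component"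
begin

text \<open>
  A bit is a Boolean, with \<open>0\<close> as \<^term>\<open>False\<close> and \<open>1\<close> as \<^term>\<open>True\<close>. The first bit of a
  sequence is the head of the list, so that \<open>\<alpha>0\<close> is \<open>\<alpha> @ [False]\<close> and \<open>\<alpha>1\<close> is \<open>\<alpha> @ [True]\<close>.
\<close>

type_synonym bitseq = "bool list"

definition weight :: "bitseq \<Rightarrow> nat" where
  "weight \<alpha> = count_list \<alpha> True"

definition C1 :: "bitseq set \<Rightarrow> bool" where
  "C1 \<Omega> \<longleftrightarrow> [] \<in> \<Omega> \<and> (\<forall>\<alpha>\<in>\<Omega> - {[]}. butlast \<alpha> \<in> \<Omega>)"

definition maximal_in :: "bitseq \<Rightarrow> bitseq set \<Rightarrow> bool" where
  "maximal_in \<alpha> \<Omega> \<longleftrightarrow> \<alpha> \<in> \<Omega> \<and> {\<alpha> @ [False], \<alpha> @ [True]} \<inter> \<Omega> = {}"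

text \<open>
  Vectors indexed by \<open>\<Omega> \<union> {*}\<close> are extensional functions on the index set below, in which
  \<^term>\<open>None\<close> is the extra symbol \<open>*\<close>. The two constructors of the type of vertices provide the two
  disjoint copies of the vector space.
\<close>

definition index :: "bitseq set \<Rightarrow> bitseq option set" where
  "index \<Omega> = insert None (Some ` \<Omega>)"

datatype 'a vertex =
    LVec (entry: "bitseq option \<Rightarrow> 'a")
  | RVec (entry: "bitseq option \<Rightarrow> 'a")

definition left_vertices :: "bitseq set \<Rightarrow> 'a vertex set" where
  "left_vertices \<Omega> = LVec ` (index \<Omega> \<rightarrow>\<^sub>E UNIV)"

definition right_vertices :: "bitseq set \<Rightarrow> 'a vertex set" where
  "right_vertices \<Omega> = RVec ` (index \<Omega> \<rightarrow>\<^sub>E UNIV)"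

definition adjacent ::
    "bitseq set \<Rightarrow> (bitseq option \<Rightarrow> 'a::field) \<Rightarrow> (bitseq option \<Rightarrow> 'a) \<Rightarrow> bool" where
  "adjacent \<Omega> l r \<longleftrightarrow>
     l (Some []) + r (Some []) = l None * r None \<and>
     (\<forall>\<alpha>. \<alpha> @ [False] \<in> \<Omega> \<longrightarrow>
        l (Some (\<alpha> @ [False])) + r (Some (\<alpha> @ [False])) = r None * l (Some \<alpha>)) \<and>
     (\<forall>\<beta>. \<beta> @ [True] \<in> \<Omega> \<longrightarrow>
        l (Some (\<beta> @ [True])) + r (Some (\<beta> @ [True])) = l None * r (Some \<beta>))"

text \<open>An undirected graph is represented as a symmetric digraph.\<close>

definition Gam :: "bitseq set \<Rightarrow> 'a::field vertex pair_pre_digraph" where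
  "Gam \<Omega> =
     (let E = {(LVec l, RVec r) | l r.
                 LVec l \<in> left_vertices \<Omega> \<and> RVec r \<in> right_vertices \<Omega> \<and> adjacent \<Omega> l r}
      in \<lparr> pverts = left_vertices \<Omega> \<union> right_vertices \<Omega>, parcs = E \<union> E\<inverse> \<rparr>)"

definition components :: "'v pair_pre_digraph \<Rightarrow> 'v pair_pre_digraph set" where
  "components H =
     {C. pre_digraph.max_subgraph (with_proj H) Digraph_Component.connected (with_proj C)}"

text \<open>The projection keeping the entries indexed by \<open>\<Omega>' \<union> {*}\<close>, on vertices and on subgraphs.\<close>

definition proj :: "bitseq set \<Rightarrow> 'a vertex \<Rightarrow> 'a vertex" where
  "proj \<Omega>' v = (case v of
       LVec l \<Rightarrow> LVec (restrict l (index \<Omega>'))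
     | RVec r \<Rightarrow> RVec (restrict r (index \<Omega>')))"

definition proj_graph ::
    "bitseq set \<Rightarrow> 'a vertex pair_pre_digraph \<Rightarrow> 'a vertex pair_pre_digraph" where
  "proj_graph \<Omega>' C =
     \<lparr> pverts = proj \<Omega>' ` pverts C, parcs = map_prod (proj \<Omega>') (proj \<Omega>') ` parcs C \<rparr>"

definition lifts ::
    "bitseq set \<Rightarrow> bitseq set \<Rightarrow> 'a::field vertex pair_pre_digraph
       \<Rightarrow> 'a vertex pair_pre_digraph set" where
  "lifts \<Omega> \<Omega>' C' = {C \<in> components (Gam \<Omega>). proj_graph \<Omega>' C = C'}"

definition rho ::
    "bitseq set \<Rightarrow> bitseq \<Rightarrow> 'a vertex \<Rightarrow> 'a vertex pair_pre_digraph \<Rightarrow> 'a set" where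
  "rho \<Omega>' \<alpha> u C = {entry v (Some \<alpha>) | v. v \<in> pverts C \<and> proj \<Omega>' v = u}"

definition zero_vec :: "bitseq set \<Rightarrow> bitseq option \<Rightarrow> 'a::zero" where
  "zero_vec \<Omega> = (\<lambda>i\<in>index \<Omega>. 0)"

definition additive_subgroup :: "'a::group_add set \<Rightarrow> bool" where
  "additive_subgroup G \<longleftrightarrow> 0 \<in> G \<and> (\<forall>x\<in>G. \<forall>y\<in>G. x + y \<in> G) \<and> (\<forall>x\<in>G. - x \<in> G)"

end

theory Submission
  imports
    Defs
    "HOL-Computational_Algebra.Polynomial"
    "HOL-Number_Theory.Cong"
begin

text \<open>
The larger graph is a regular covering of the smaller one, with the additive group of the field as
group of deck transformations. As \<open>\<alpha>\<close> is maximal, the entry \<open>\<alpha>\<close> occurs only in one adjacency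
equation, which prescribes \<open>l\<^sub>\<alpha> + r\<^sub>\<alpha>\<close> in terms of the other entries. Hence walks of the smaller graph
lift uniquely from a given starting point, and adding a constant to the entry \<open>\<alpha>\<close> on the left while
subtracting it on the right is an automorphism that permutes each fibre transitively
(\<open>regular_cover_Gam\<close>).

Fix a vertex \<open>v\<close> over the component \<open>C'\<close>, and let \<open>G\<close> be its holonomy group, the set of displacements
of \<open>v\<close> that lie in the component of \<open>v\<close>. General covering theory says that the components over \<open>C'\<close>
are the translates of the component of \<open>v\<close> (\<open>components_over\<close>), that they correspond to the cosets of \<open>G\<close>
(\<open>coset_labelling\<close>), and that a component meets each fibre in a coset of \<open>G\<close> (\<open>component_fibre\<close>). Let \<open>f u\<close>
be the entry \<open>\<alpha>\<close> of the end point of a walk that starts at \<open>v\<close> and lies over a walk to \<open>u\<close>, and \<open>g C\<close> a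
displacement that takes \<open>v\<close> into \<open>C\<close>. The formula for the fibres follows, with opposite signs on the
two sides because displacements are subtracted on the right.

If \<open>C'\<close> contains the zero vertices, take \<open>v\<close> to be zero. Scaling \<open>l\<^sub>*\<close> by \<open>a\<close> and \<open>r\<^sub>*\<close> by \<open>b\<close> extends to a
symmetry that fixes \<open>v\<close> and multiplies the entry \<open>\<alpha>\<close> by the product of \<open>a\<close> to the power \<open>w(\<alpha>) + 1\<close> and
\<open>b\<close> to the power \<open>length \<alpha> - w(\<alpha>) + 1\<close>. So \<open>G\<close> is closed under multiplication by all \<open>d\<close>-th powers, where \<open>d\<close>
is the greatest common divisor of these exponents and \<open>q - 1\<close>. The nonzero \<open>d\<close>-th powers form a group of
order \<open>(q - 1) / d\<close> that acts freely on \<open>G - {0}\<close>, and \<open>G\<close> has order \<open>p\<^sup>k\<close> for some \<open>k\<close>. Therefore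
\<open>(q - 1) / d\<close> divides \<open>p\<^sup>k - 1\<close>, which forces the least such positive exponent \<open>n\<close> to divide \<open>k\<close>
(\<open>card_power_invariant_subgroup\<close>).
\<close>

section \<open>Additive subgroups of finite fields\<close>

lemma card_power_eq_le:
  fixes c :: "'a::{idom,finite}"
  assumes "n > 0"
  shows "card {x. x ^ n = c} \<le> n"
proof -
  let ?P = "monom 1 n - [:c:]"
  have "degree ?P \<le> n"
    by (intro degree_diff_le) (simp_all add: degree_monom_le)
  moreover have "coeff ?P n = 1"
    using assms by (simp add: coeff_pCons split: nat.split)
  then have "?P \<noteq> 0"
    by (metis coeff_0 zero_neq_one)
  ultimately have "card {x. poly ?P x = 0} \<le> n"
    using card_poly_roots_bound[of ?P] by simp
  then show ?thesis
    by (simp add: poly_monom)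
qed

lemma power_card_minus_one_eq_1:
  fixes x :: "'a::{field,finite}"
  assumes "x \<noteq> 0"
  shows "x ^ (CARD('a) - 1) = 1"
proof -
  let ?U = "UNIV - {0 :: 'a}"
  have "(\<Prod>y\<in>?U. y) = (\<Prod>y\<in>?U. x * y)"
    using assms
    by (intro prod.reindex_bij_witness[where i = "\<lambda>y. x * y" and j = "\<lambda>y. y / x"]) auto
  also have "\<dots> = x ^ card ?U * (\<Prod>y\<in>?U. y)"
    by (simp add: prod.distrib)
  finally show ?thesis
    by (simp add: card_Diff_singleton)
qed

text \<open>
Write \<open>q - 1 = d N\<close>. The nonzero \<open>d\<close>-th powers are roots of \<open>X\<^sup>N - 1\<close>, so there are at most
\<open>N\<close> of them, and each is hit by at most \<open>d\<close> of the \<open>q - 1\<close> nonzero elements. Both bounds must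
therefore be attained.
\<close>

lemma card_nonzero_powers:
  assumes "d dvd CARD('a::{field,finite}) - 1"
  shows "card ((\<lambda>x::'a. x ^ d) ` (UNIV - {0})) * d = CARD('a) - 1"
proof -
  let ?U = "UNIV - {0 :: 'a}" and ?P = "(\<lambda>x::'a. x ^ d) ` (UNIV - {0})"
  obtain N where N: "CARD('a) - 1 = d * N"
    using assms by (auto elim: dvdE)
  have cU: "card ?U = CARD('a) - 1"
    by (simp add: card_Diff_singleton)
  have "card {0, 1 :: 'a} \<le> CARD('a)"
    by (intro card_mono) auto
  then have "d * N \<noteq> 0"
    unfolding N[symmetric] by simp
  then have d: "d > 0" and N0: "N > 0" by auto
  have "?P \<subseteq> {y. y ^ N = 1}"
    using power_card_minus_one_eq_1[where 'a = 'a] N by (auto simp flip: power_mult)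
  then have "card ?P \<le> N"
    using card_power_eq_le[OF N0, of "1 :: 'a"] card_mono[of "{y :: 'a. y ^ N = 1}" ?P] by simp
  moreover have "card ?U \<le> card ?P * d"
  proof -
    have "card ?U \<le> card (\<Union>y\<in>?P. {x. x ^ d = y})"
      by (intro card_mono) auto
    also have "\<dots> \<le> (\<Sum>y\<in>?P. card {x. x ^ d = y})"
      by (intro card_UN_le) auto
    also have "\<dots> \<le> of_nat (card ?P) * d"
      by (intro sum_bounded_above card_power_eq_le d)
    finally show ?thesis by simp
  qed
  ultimately show ?thesis
    using cU N by (auto intro!: antisym simp: mult.commute)
qed

text \<open>
The group of nonzero \<open>d\<close>-th powers acts freely on \<open>G - {0}\<close> by multiplication, because a
field has no zero divisors. All orbits have as many elements as that group, namely \<open>(q - 1) / d\<close>.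
\<close>

lemma card_dvd_of_power_invariant:
  fixes G :: "'a::{field,finite} set"
  assumes "d dvd CARD('a) - 1" and "0 \<in> G"
    and inv: "\<And>x y. x \<noteq> 0 \<Longrightarrow> y \<in> G \<Longrightarrow> x ^ d * y \<in> G"
  shows "CARD('a) - 1 dvd (card G - 1) * d"
proof -
  let ?P = "(\<lambda>x::'a. x ^ d) ` (UNIV - {0})"
  let ?orb = "\<lambda>y. (\<lambda>c. c * y) ` ?P"
  have un: "\<Union>(?orb ` (G - {0})) = G - {0}"
  proof -
    have "y \<in> ?orb y" for y
      by (rule image_eqI[of _ _ 1]) (auto intro!: image_eqI[of _ _ 1])
    then show ?thesis
      using inv by auto
  qed
  have "card (?orb y) = card ?P" if "y \<noteq> 0" for y
    by (intro card_image) (use that in \<open>auto simp: inj_on_def\<close>)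
  moreover have "?orb y = ?orb z" if "u \<in> ?orb y" "u \<in> ?orb z" for u y z
  proof -
    have "?orb y \<subseteq> ?orb z" if yz: "u \<in> ?orb y" "u \<in> ?orb z" for y z
    proof
      fix v assume "v \<in> ?orb y"
      then obtain x where x: "x \<noteq> 0" "v = x ^ d * y" by auto
      obtain a b where ab: "a \<noteq> 0" "b \<noteq> 0" "a ^ d * y = b ^ d * z"
        using yz by force
      have "a ^ d * v = x ^ d * (a ^ d * y)"
        by (simp add: x)
      also have "\<dots> = a ^ d * ((x * b / a) ^ d * z)"
        using ab by (simp add: power_mult_distrib power_divide)
      finally have "v = (x * b / a) ^ d * z"
        using ab by simp
      moreover have "x * b / a \<noteq> 0"
        using x ab by simp
      ultimately show "v \<in> ?orb z" by blast
    qed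
    from this[of y z] this[of z y] that show ?thesis by blast
  qed
  ultimately have "card ?P dvd card (\<Union>(?orb ` (G - {0})))"
    by (intro dvd_partition) (simp, force, blast)
  then have "card ?P dvd card G - 1"
    using \<open>0 \<in> G\<close> by (simp only: un) (simp add: card_Diff_singleton)
  then show ?thesis
    unfolding card_nonzero_powers[OF assms(1), symmetric] by (rule mult_dvd_mono) simp
qed

lemma additive_subgroup_of_nat_mult:
  "additive_subgroup G \<Longrightarrow> x \<in> G \<Longrightarrow> of_nat i * (x :: 'a::ring_1) \<in> G"
  by (induction i) (auto simp: additive_subgroup_def algebra_simps)

lemma additive_subgroup_diff:
  "additive_subgroup G \<Longrightarrow> x \<in> G \<Longrightarrow> y \<in> G \<Longrightarrow> x - y \<in> (G :: 'a::group_add set)"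
  unfolding additive_subgroup_def by (metis diff_conv_add_uminus)

text \<open>
Among the subgroups of \<open>G\<close> whose order is a power of the characteristic \<open>p\<close>, one of maximal
order is all of \<open>G\<close>: adjoining the multiples of a missing element would multiply its order by
\<open>p\<close>.
\<close>

lemma card_additive_subgroup:
  fixes G :: "'a::{field,finite} set"
  assumes G: "additive_subgroup G"
  shows "\<exists>k. card G = CHAR('a) ^ k"
proof -
  let ?p = "CHAR('a)"
  have p: "prime ?p"
    by (simp add: prime_CHAR_semidom finite_imp_CHAR_pos)
  define good where "good S \<longleftrightarrow> S \<subseteq> G \<and> additive_subgroup S \<and> (\<exists>k. card S = ?p ^ k)"
    for S :: "'a set"
  have "good {0}"
    using G by (auto simp: good_def additive_subgroup_def intro: exI[of _ 0])
  then obtain S where S: "good S" and max: "\<And>T. good T \<Longrightarrow> card T \<le> card S"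
    using ex_has_greatest_nat[of good "{0}" card "Suc CARD('a)"]
    by (metis card_mono finite subset_UNIV less_Suc_eq_le)
  have "G \<subseteq> S"
  proof (rule ccontr)
    assume "\<not> G \<subseteq> S"
    then obtain x where x: "x \<in> G" "x \<notin> S" by auto
    have subS: "additive_subgroup S" using S by (simp add: good_def)
    let ?h = "\<lambda>(i, y). of_nat i * x + y"
    let ?T = "?h ` ({..<?p} \<times> S)"
    have T: "of_nat i * x + y \<in> ?T" if "y \<in> S" for i y
    proof (rule image_eqI[of _ _ "(i mod ?p, y)"])
      have "(of_nat (i mod ?p) :: 'a) = of_nat i"
        by (simp add: of_nat_eq_iff_cong_CHAR)
      then show "of_nat i * x + y = ?h (i mod ?p, y)" by simp
    qed (use that in \<open>simp add: finite_imp_CHAR_pos\<close>)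
    \<comment> \<open>If two representations agree but \<open>i < j\<close>, then \<open>(j - i) x \<in> S\<close>, and inverting \<open>j - i\<close>
      modulo \<open>p\<close> puts \<open>x\<close> itself into \<open>S\<close>.\<close>
    have inj: "inj_on ?h ({..<?p} \<times> S)"
    proof -
      have *: "i = j" if "i \<le> j" "j < ?p" "y \<in> S" "z \<in> S" "of_nat i * x + y = of_nat j * x + z" for i j y z
      proof (rule ccontr)
        assume "i \<noteq> j"
        then have "coprime (j - i) ?p"
          using that \<open>i \<noteq> j\<close> by (subst coprime_commute) (auto intro!: prime_imp_coprime p dest: dvd_imp_le)
        then obtain m where "[(j - i) * m = 1] (mod ?p)"
          using cong_solve_coprime_nat by auto
        then have "(of_nat (j - i) * of_nat m :: 'a) = 1"
          by (metis of_nat_1 of_nat_eq_iff_cong_CHAR of_nat_mult)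
        moreover have "of_nat (j - i) * x = y - z"
          using that by (simp add: of_nat_diff algebra_simps)
        ultimately have "x = of_nat m * (y - z)"
          by (metis mult.assoc mult.commute mult_1)
        then show False
          using x(2) additive_subgroup_of_nat_mult[OF subS
              additive_subgroup_diff[OF subS \<open>y \<in> S\<close> \<open>z \<in> S\<close>], of m] by simp
      qed
      have "i = j \<and> y = z" if "i < ?p" "j < ?p" "y \<in> S" "z \<in> S" "of_nat i * x + y = of_nat j * x + z" for i j y z
      proof -
        have "i = j"
          using *[of i j y z] *[of j i z y] that by (metis nat_le_linear)
        then show ?thesis using that by simp
      qed
      then show ?thesis by (auto simp: inj_on_def)
    qed
    have "good ?T"
      unfolding good_def additive_subgroup_def
    proof (intro conjI ballI)
      show "?T \<subseteq> G"
        using S x G by (auto simp: good_def additive_subgroup_of_nat_mult)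
          (meson G additive_subgroup_def additive_subgroup_of_nat_mult subsetD)
      show "0 \<in> ?T"
        using T[of 0 0] subS by (simp add: additive_subgroup_def)
      show "u + v \<in> ?T" if uv: "u \<in> ?T" "v \<in> ?T" for u v
      proof -
        obtain i y j z where "y \<in> S" "z \<in> S" "u = of_nat i * x + y" "v = of_nat j * x + z"
          using uv by auto
        then show ?thesis
          using T[of "y + z" "i + j"] subS by (simp add: additive_subgroup_def algebra_simps)
      qed
      show "- u \<in> ?T" if u: "u \<in> ?T" for u
      proof -
        obtain i y where iy: "i < ?p" "y \<in> S" "u = of_nat i * x + y"
          using u by auto
        then show ?thesis
          using T[of "- y" "?p - i"] subS
          by (simp add: additive_subgroup_def algebra_simps of_nat_diff)
      qed
      show "\<exists>k. card ?T = ?p ^ k"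
        using S card_image[OF inj] by (auto simp: good_def card_cartesian_product intro: exI[of _ "Suc _"])
    qed
    then have "?p * card S \<le> card S"
      using max[of ?T] card_image[OF inj] by (simp add: card_cartesian_product)
    moreover have "card S > 0"
      using subS by (auto simp: additive_subgroup_def card_gt_0_iff)
    moreover have "?p > 1"
      using p by (rule prime_gt_1_nat)
    ultimately show False by simp
  qed
  then show ?thesis
    using S by (auto simp: good_def)
qed

text \<open>
The exponents \<open>k\<close> with \<open>p\<^sup>k\<close> congruent to \<open>1\<close> modulo \<open>N\<close> are the multiples of the
multiplicative order of \<open>p\<close>: the remainder of \<open>k\<close> modulo the least positive one is again such
an exponent, hence zero.
\<close>

lemma least_exponent_dvd:
  fixes p N k n :: nat
  assumes "p > 0" and n: "n = (LEAST k. k > 0 \<and> N dvd p ^ k - 1)"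
    and ex: "\<exists>k>0. N dvd p ^ k - 1" and "N dvd p ^ k - 1"
  shows "n > 0" and "n dvd k"
proof -
  have cong: "[p ^ k = 1] (mod N) \<longleftrightarrow> N dvd p ^ k - 1" for k
    using \<open>p > 0\<close> by (metis One_nat_def Suc_leI cong_altdef_nat zero_less_power)
  have n': "n > 0 \<and> N dvd p ^ n - 1"
    unfolding n by (rule LeastI_ex) (use ex in blast)
  then show "n > 0" ..
  have "[p ^ (k mod n) = (p ^ n) ^ (k div n) * p ^ (k mod n)] (mod N)"
    using n' cong_pow[of "p ^ n" 1 N "k div n"] cong
    by (metis cong_scalar_right cong_sym mult_1 power_one)
  also have "(p ^ n) ^ (k div n) * p ^ (k mod n) = p ^ k"
    by (simp flip: power_mult power_add)
  also have "[p ^ k = 1] (mod N)"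
    using assms(4) cong by blast
  finally have "N dvd p ^ (k mod n) - 1"
    using cong by blast
  then have "\<not> k mod n > 0"
    using not_less_Least[of "k mod n" "\<lambda>k. k > 0 \<and> N dvd p ^ k - 1"] n n' by auto
  then show "n dvd k"
    by (simp add: mod_eq_0_iff_dvd)
qed

text \<open>
The order of \<open>G\<close> is \<open>p\<^sup>k\<close> for some \<open>k\<close>, and counting orbits gives
\<open>q - 1 dvd (p\<^sup>k - 1) d\<close>, that is, \<open>p\<^sup>k\<close> is \<open>1\<close> modulo \<open>N = (q - 1) / d\<close>. So the least positive
such exponent \<open>n\<close> divides \<open>k\<close>. There is such an exponent at all because \<open>q\<close> itself is a power
of \<open>p\<close>.
\<close>

lemma card_power_invariant_subgroup:
  fixes G :: "'a::{field,finite} set" and n d :: nat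
  assumes G: "additive_subgroup G"
    and inv: "\<And>x y. x \<noteq> 0 \<Longrightarrow> y \<in> G \<Longrightarrow> x ^ d * y \<in> G"
    and d: "d dvd CARD('a) - 1"
    and n: "n = (LEAST k. k > 0 \<and> CARD('a) - 1 dvd (CHAR('a) ^ k - 1) * d)"
  shows "n > 0" and "\<exists>m. card G = CHAR('a) ^ (m * n)"
proof -
  let ?p = "CHAR('a)"
  obtain N where N: "CARD('a) - 1 = d * N"
    using d by (auto elim: dvdE)
  have two: "card {0, 1 :: 'a} \<le> CARD('a)"
    by (intro card_mono) auto
  then have "d * N \<noteq> 0"
    unfolding N[symmetric] by simp
  then have dvd_iff: "CARD('a) - 1 dvd c * d \<longleftrightarrow> N dvd c" for c
    unfolding N by (simp add: mult.commute[of _ d])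
  obtain e where e: "CARD('a) = ?p ^ e"
    using card_additive_subgroup[of "UNIV :: 'a set"] by (auto simp: additive_subgroup_def)
  have "e > 0 \<and> N dvd ?p ^ e - 1"
    using two e N by (cases e) auto
  then have ex: "\<exists>k>0. N dvd ?p ^ k - 1"
    by blast
  obtain k where k: "card G = ?p ^ k"
    using card_additive_subgroup[OF G] by auto
  have "0 \<in> G"
    using G by (simp add: additive_subgroup_def)
  then have "CARD('a) - 1 dvd (card G - 1) * d"
    by (intro card_dvd_of_power_invariant[OF d] inv)
  then have "N dvd ?p ^ k - 1"
    by (simp only: k dvd_iff)
  from least_exponent_dvd[OF _ n[unfolded dvd_iff] ex this]
  have "n > 0" "n dvd k"
    by (simp_all add: finite_imp_CHAR_pos)
  then show "n > 0" "\<exists>m. card G = ?p ^ (m * n)"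
    using k by (auto elim!: dvdE simp: mult.commute)
qed

section \<open>Components as reachability classes\<close>

definition component_of :: "'v pair_pre_digraph \<Rightarrow> 'v \<Rightarrow> 'v pair_pre_digraph" where
  "component_of H v =
     (let S = (parcs H)\<^sup>* `` {v} in \<lparr> pverts = S, parcs = parcs H \<inter> S \<times> S \<rparr>)"

lemma pverts_component_of: "w \<in> pverts (component_of H v) \<longleftrightarrow> (v, w) \<in> (parcs H)\<^sup>*"
  by (simp add: component_of_def Let_def)

lemma parcs_component_of:
  "(u, w) \<in> parcs (component_of H v) \<longleftrightarrow> (u, w) \<in> parcs H \<and> (v, u) \<in> (parcs H)\<^sup>*"
  by (auto simp: component_of_def Let_def intro: rtrancl_into_rtrancl)

lemma with_proj_inject: "with_proj G = with_proj H \<longleftrightarrow> G = H"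
  by (auto simp: with_proj_def intro: pair_pre_digraph.equality)

text \<open>
Connectivity refers to the symmetric closure of \<open>K\<close>. As \<open>H\<close> is symmetric already, that closure
stays inside \<open>H\<close>.
\<close>

lemma connected_subgraph_reach:
  assumes "subgraph K (with_proj H)" and "connected K" and sym: "sym (parcs H)"
    and "u \<in> verts K" "v \<in> verts K"
  shows "(u, v) \<in> (parcs H)\<^sup>*"
proof -
  have "tail K = fst" "head K = snd" "arcs K \<subseteq> parcs H"
    using assms(1) by (auto simp: subgraph_def compatible_def)
  then have "parcs (mk_symmetric K) \<subseteq> parcs H"
    using sym by (auto simp: mk_symmetric_def dest: symD)
  moreover have "(u, v) \<in> (arcs_ends (with_proj (mk_symmetric K)))\<^sup>*"
    using assms(2,4,5)
    by (intro reachable_rtranclI) (auto simp: connected_def strongly_connected_def mk_symmetric_def)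
  ultimately show ?thesis
    using rtrancl_mono by auto
qed

lemma connected_component_of:
  assumes sym: "sym (parcs H)"
  shows "connected (with_proj (component_of H v))"
proof -
  let ?C = "component_of H v"
  let ?r = "rtrancl_on (pverts ?C) (parcs (mk_symmetric (with_proj ?C)))"
  have arc: "(u, w) \<in> parcs (mk_symmetric (with_proj ?C))" "(w, u) \<in> parcs (mk_symmetric (with_proj ?C))"
    if "(u, w) \<in> parcs ?C" for u w
  proof -
    have "parcs (mk_symmetric (with_proj ?C)) = parcs ?C \<union> (parcs ?C)\<inverse>"
      by (auto simp: mk_symmetric_def)
    then show "(u, w) \<in> parcs (mk_symmetric (with_proj ?C))" "(w, u) \<in> parcs (mk_symmetric (with_proj ?C))"
      using that by auto
  qed
  have "(v, w) \<in> ?r \<and> (w, v) \<in> ?r" if "(v, w) \<in> (parcs H)\<^sup>*" for w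
    using that
  proof induction
    case base
    show ?case by (simp add: pverts_component_of)
  next
    case (step y z)
    then have "(y, z) \<in> parcs ?C" "z \<in> pverts ?C"
      by (auto simp: parcs_component_of pverts_component_of)
    then show ?case
      using step.IH arc
      by (meson converse_rtrancl_on_into_rtrancl_on rtrancl_on_into_rtrancl_on)
  qed
  then have "(u, w) \<in> ?r" if "u \<in> pverts ?C" "w \<in> pverts ?C" for u w
    using that rtrancl_on_trans by (metis pverts_component_of)
  moreover have "pverts (mk_symmetric (with_proj ?C)) = pverts ?C" "v \<in> pverts ?C"
    by (simp_all add: mk_symmetric_def pverts_component_of)
  ultimately show ?thesis
    unfolding connected_def strongly_connected_def reachable_def by auto
qed

lemma subgraph_component_of:
  assumes "parcs H \<subseteq> pverts H \<times> pverts H" and "v \<in> pverts H"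
  shows "subgraph (with_proj (component_of H v)) (with_proj H)"
proof -
  have "w \<in> pverts H" if "(v, w) \<in> (parcs H)\<^sup>*" for w
    using that assms by (induction) auto
  then show ?thesis
    using assms
    by (auto simp: subgraph_def compatible_def wf_digraph_def component_of_def Let_def)
qed

text \<open>
A connected subgraph containing \<open>v\<close> has all its vertices in the reachability class of \<open>v\<close>, and
that class induces a connected subgraph, which is thus the largest connected subgraph through \<open>v\<close>.
\<close>

lemma components_eq_component_of:
  assumes sym: "sym (parcs H)" and wf: "parcs H \<subseteq> pverts H \<times> pverts H"
  shows "components H = component_of H ` pverts H"
proof (intro set_eqI iffI)
  fix C assume "C \<in> component_of H ` pverts H"
  then obtain v where v: "v \<in> pverts H" "C = component_of H v" by auto
  have "K = with_proj C"
    if K: "subgraph (with_proj C) K" "subgraph K (with_proj H)" "connected K" for K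
  proof -
    have vK: "v \<in> verts K"
      using K(1) v by (auto simp: subgraph_def pverts_component_of)
    have vs: "verts K = pverts C"
    proof
      show "verts K \<subseteq> pverts C"
        using connected_subgraph_reach[OF K(2,3) sym vK] v by (auto simp: pverts_component_of)
      show "pverts C \<subseteq> verts K"
        using K(1) by (auto simp: subgraph_def)
    qed
    have ht: "tail K = fst" "head K = snd"
      using K(2) by (auto simp: subgraph_def compatible_def)
    have "arcs K = parcs C"
    proof
      have "fst e \<in> verts K \<and> snd e \<in> verts K \<and> e \<in> parcs H" if "e \<in> arcs K" for e
        using K(2) that ht by (cases e) (auto simp: subgraph_def wf_digraph_def)
      then show "arcs K \<subseteq> parcs C"
        unfolding vs v(2) by (auto simp: parcs_component_of pverts_component_of)
      show "parcs C \<subseteq> arcs K"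
        using K(1) by (auto simp: subgraph_def)
    qed
    then show ?thesis
      using vs ht by (auto simp: with_proj_def intro: pre_digraph.equality)
  qed
  then show "C \<in> components H"
    using subgraph_component_of[OF wf v(1)] connected_component_of[OF sym, of v] v(2)
    by (auto simp: components_def pre_digraph.max_subgraph_def)
next
  fix C assume "C \<in> components H"
  then have C: "subgraph (with_proj C) (with_proj H)" "connected (with_proj C)"
    and max: "\<And>K. K \<noteq> with_proj C \<Longrightarrow> subgraph (with_proj C) K \<Longrightarrow> subgraph K (with_proj H)
                \<Longrightarrow> \<not> connected K"
    by (auto simp: components_def pre_digraph.max_subgraph_def)
  obtain v where v: "v \<in> pverts C"
    using C(2) by (auto simp: connected_def strongly_connected_def mk_symmetric_def)
  then have vH: "v \<in> pverts H"
    using C(1) by (auto simp: subgraph_def)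
  have "subgraph (with_proj C) (with_proj (component_of H v))"
  proof -
    have "(v, w) \<in> (parcs H)\<^sup>*" if "w \<in> pverts C" for w
      using connected_subgraph_reach[OF C sym] v that by simp
    then show ?thesis
      using C(1) subgraph_component_of[OF wf vH]
      by (auto simp: subgraph_def compatible_def pverts_component_of parcs_component_of wf_digraph_def) blast+
  qed
  then have "with_proj (component_of H v) = with_proj C"
    using max subgraph_component_of[OF wf vH] connected_component_of[OF sym, of v] by metis
  then show "C \<in> component_of H ` pverts H"
    using vH by (auto simp: with_proj_inject)
qed

lemma component_of_eq_iff:
  assumes "sym (parcs H)"
  shows "component_of H v = component_of H w \<longleftrightarrow> (v, w) \<in> (parcs H)\<^sup>*"
proof
  assume "component_of H v = component_of H w"
  then show "(v, w) \<in> (parcs H)\<^sup>*"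
    using pverts_component_of by (metis rtrancl.rtrancl_refl)
next
  assume vw: "(v, w) \<in> (parcs H)\<^sup>*"
  then have "(w, v) \<in> (parcs H)\<^sup>*"
    using sym_rtrancl[OF assms] by (simp add: symD)
  then have "(parcs H)\<^sup>* `` {v} = (parcs H)\<^sup>* `` {w}"
    using vw by (auto intro: rtrancl_trans)
  then show "component_of H v = component_of H w"
    by (simp add: component_of_def)
qed

section \<open>Regular coverings with abelian deck group\<close>

text \<open>
A regular covering \<open>\<pi>\<close> of a graph by a graph on which an abelian group acts by deck
transformations, transitively on each fibre. Displacing a vertex by an element of the group is written
additively, so that in the application it becomes adding to one coordinate.
\<close>

locale regular_cover =
  fixes H :: "'v pair_pre_digraph" and H' :: "'w pair_pre_digraph"
    and \<pi> :: "'v \<Rightarrow> 'w" and shift :: "'a::ab_group_add \<Rightarrow> 'v \<Rightarrow> 'v"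
  assumes sym_cover: "sym (parcs H)" and wf_cover: "parcs H \<subseteq> pverts H \<times> pverts H"
    and sym_base: "sym (parcs H')" and wf_base: "parcs H' \<subseteq> pverts H' \<times> pverts H'"
    and proj_arc: "(v, w) \<in> parcs H \<Longrightarrow> (\<pi> v, \<pi> w) \<in> parcs H'"
    and lift_arc: "v \<in> pverts H \<Longrightarrow> (\<pi> v, u) \<in> parcs H' \<Longrightarrow> \<exists>w. (v, w) \<in> parcs H \<and> \<pi> w = u"
    and lift_vertex: "u \<in> pverts H' \<Longrightarrow> \<exists>v\<in>pverts H. \<pi> v = u"
    and shift_0: "shift 0 v = v"
    and shift_add: "shift (a + b) v = shift a (shift b v)"
    and shift_vertex: "v \<in> pverts H \<Longrightarrow> shift a v \<in> pverts H"
    and shift_arc: "(v, w) \<in> parcs H \<Longrightarrow> (shift a v, shift a w) \<in> parcs H"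
    and proj_shift: "\<pi> (shift a v) = \<pi> v"
    and fibre: "v \<in> pverts H \<Longrightarrow> w \<in> pverts H \<Longrightarrow> \<pi> v = \<pi> w \<Longrightarrow> \<exists>a. w = shift a v"
begin

text \<open>
These are the net displacements along lifts of the closed walks at \<open>\<pi> v\<close>.
\<close>

definition holonomy :: "'v \<Rightarrow> 'a set" where
  "holonomy v = {a. (v, shift a v) \<in> (parcs H)\<^sup>*}"

lemma reach_sym: "(v, w) \<in> (parcs H)\<^sup>* \<Longrightarrow> (w, v) \<in> (parcs H)\<^sup>*"
  using sym_rtrancl[OF sym_cover] by (rule symD)

lemma reach_vertex: "(v, w) \<in> (parcs H)\<^sup>* \<Longrightarrow> v \<in> pverts H \<Longrightarrow> w \<in> pverts H"
  by (induction rule: rtrancl_induct) (use wf_cover in auto)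

lemma reach_shift:
  "(shift a v, shift a w) \<in> (parcs H)\<^sup>* \<longleftrightarrow> (v, w) \<in> (parcs H)\<^sup>*"
proof -
  have *: "(shift a v, shift a w) \<in> (parcs H)\<^sup>*" if "(v, w) \<in> (parcs H)\<^sup>*" for a v w
    using that by induction (auto intro: shift_arc rtrancl_into_rtrancl)
  show ?thesis
    using *[of v w a] *[of "shift a v" "shift a w" "- a"]
    by (auto simp: shift_0 simp flip: shift_add)
qed

lemma reach_proj: "(v, w) \<in> (parcs H)\<^sup>* \<Longrightarrow> (\<pi> v, \<pi> w) \<in> (parcs H')\<^sup>*"
  by (induction rule: rtrancl_induct) (auto intro: proj_arc rtrancl_into_rtrancl)

lemma lift_reach:
  assumes "(\<pi> v, u) \<in> (parcs H')\<^sup>*" and "v \<in> pverts H"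
  shows "\<exists>w. (v, w) \<in> (parcs H)\<^sup>* \<and> \<pi> w = u"
  using assms(1)
proof induction
  case (step y z)
  then obtain w where w: "(v, w) \<in> (parcs H)\<^sup>*" "\<pi> w = y" by auto
  then show ?case
    using lift_arc[of w z] reach_vertex[OF w(1) assms(2)] step.hyps by (auto intro: rtrancl_into_rtrancl)
qed auto

text \<open>
The basic criterion. Since deck transformations preserve reachability, \<open>w\<close> may be replaced by \<open>v\<close>,
and then the common displacement \<open>a\<close> removed. In particular the displacements that stay in a component
form the same group at every vertex of that component and at all its translates.
\<close>

lemma reach_shift_shift:
  assumes "(v, w) \<in> (parcs H)\<^sup>*"
  shows "(shift a v, shift b w) \<in> (parcs H)\<^sup>* \<longleftrightarrow> b - a \<in> holonomy v"
proof -
  have "(shift a v, shift b w) \<in> (parcs H)\<^sup>* \<longleftrightarrow> (shift a v, shift b v) \<in> (parcs H)\<^sup>*"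
    using assms reach_sym reach_shift by (meson rtrancl_trans)
  also have "\<dots> \<longleftrightarrow> (shift a v, shift a (shift (b - a) v)) \<in> (parcs H)\<^sup>*"
    by (simp flip: shift_add)
  finally show ?thesis
    by (simp add: reach_shift holonomy_def)
qed

lemma additive_subgroup_holonomy: "additive_subgroup (holonomy v)"
proof -
  have diff: "b - a \<in> holonomy v" if "a \<in> holonomy v" "b \<in> holonomy v" for a b
    using that reach_shift_shift[of v v a b]
    by (auto simp: holonomy_def intro: rtrancl_trans reach_sym)
  have "0 \<in> holonomy v"
    by (simp add: holonomy_def shift_0)
  moreover from this have "- a \<in> holonomy v" if "a \<in> holonomy v" for a
    using diff[OF that, of 0] by simp
  ultimately show ?thesis
    unfolding additive_subgroup_def using diff by (metis add.commute diff_minus_eq_add)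
qed

text \<open>
The components lying over the component of \<open>\<pi> v\<close> are the translates of the component of \<open>v\<close>:
such a component meets the fibre of \<open>v\<close>, which consists of translates of \<open>v\<close>. Conversely walks and
arcs downstairs lift from any starting point, so that a translate maps onto the whole component
below, arcs included.
\<close>

lemma components_over:
  assumes v: "v \<in> pverts H"
  shows "{C \<in> components H. \<lparr> pverts = \<pi> ` pverts C, parcs = map_prod \<pi> \<pi> ` parcs C \<rparr>
            = component_of H' (\<pi> v)}
         = range (\<lambda>a. component_of H (shift a v))"
proof (intro set_eqI iffI)
  fix C
  assume "C \<in> {C \<in> components H. \<lparr> pverts = \<pi> ` pverts C, parcs = map_prod \<pi> \<pi> ` parcs C \<rparr>
            = component_of H' (\<pi> v)}"
  then obtain w where w: "w \<in> pverts H" "C = component_of H w"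
    and "\<pi> ` pverts C = pverts (component_of H' (\<pi> v))"
    by (auto simp: components_eq_component_of[OF sym_cover wf_cover] dest!: arg_cong[where f = pverts])
  then have "\<pi> v \<in> \<pi> ` pverts C"
    by (simp add: pverts_component_of)
  then obtain x where x: "(w, x) \<in> (parcs H)\<^sup>*" "\<pi> x = \<pi> v"
    by (auto simp: w pverts_component_of)
  then obtain a where "x = shift a v"
    using fibre v w reach_vertex by metis
  then show "C \<in> range (\<lambda>a. component_of H (shift a v))"
    using x w component_of_eq_iff[OF sym_cover] by auto
next
  fix C assume "C \<in> range (\<lambda>a. component_of H (shift a v))"
  then obtain a where C: "C = component_of H (shift a v)" by auto
  let ?v = "shift a v"
  have v': "?v \<in> pverts H" "\<pi> ?v = \<pi> v"
    using v by (simp_all add: shift_vertex proj_shift)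
  have vs: "\<pi> ` pverts C = pverts (component_of H' (\<pi> v))"
  proof (intro equalityI subsetI)
    fix u assume "u \<in> pverts (component_of H' (\<pi> v))"
    then show "u \<in> \<pi> ` pverts C"
      using lift_reach[of ?v u] v' by (auto simp: C pverts_component_of)
  qed (use reach_proj[of ?v] v' in \<open>auto simp: C pverts_component_of\<close>)
  have "map_prod \<pi> \<pi> ` parcs C = parcs (component_of H' (\<pi> v))"
  proof (intro equalityI subsetI)
    fix e assume "e \<in> map_prod \<pi> \<pi> ` parcs C"
    then show "e \<in> parcs (component_of H' (\<pi> v))"
      using reach_proj[of ?v] v' proj_arc by (auto simp: C parcs_component_of)
  next
    fix e assume e: "e \<in> parcs (component_of H' (\<pi> v))"
    obtain x y where xy: "e = (x, y)" by (cases e)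
    then have xy': "(x, y) \<in> parcs H'" "x \<in> pverts (component_of H' (\<pi> v))"
      using e by (auto simp: parcs_component_of pverts_component_of)
    then obtain w where w: "w \<in> pverts C" "x = \<pi> w"
      using vs by auto
    then have "w \<in> pverts H"
      using C v' reach_vertex by (auto simp: pverts_component_of)
    then obtain z where "(w, z) \<in> parcs H" "\<pi> z = y"
      using lift_arc w xy' by blast
    then show "e \<in> map_prod \<pi> \<pi> ` parcs C"
      using w by (auto simp: C xy parcs_component_of pverts_component_of intro!: image_eqI[of _ _ "(w, z)"])
  qed
  with vs have "\<lparr> pverts = \<pi> ` pverts C, parcs = map_prod \<pi> \<pi> ` parcs C \<rparr> = component_of H' (\<pi> v)"
    by simp
  then show "C \<in> {C \<in> components H. \<lparr> pverts = \<pi> ` pverts C, parcs = map_prod \<pi> \<pi> ` parcs C \<rparr>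
            = component_of H' (\<pi> v)}"
    using v' C by (auto simp: components_eq_component_of[OF sym_cover wf_cover])
qed

text \<open>
All fibres of a component are translates of the holonomy group, and passing to the component
displaced by \<open>a\<close> displaces every fibre by the same \<open>a\<close>. This is the source of the sum of a function
of the vertex and a function of the component.
\<close>

lemma component_fibre:
  assumes v: "v \<in> pverts H" and vw: "(v, w) \<in> (parcs H)\<^sup>*"
  shows "{x \<in> pverts (component_of H (shift a v)). \<pi> x = \<pi> w} = (\<lambda>h. shift (a + h) w) ` holonomy v"
proof (intro equalityI subsetI)
  fix x assume x: "x \<in> {x \<in> pverts (component_of H (shift a v)). \<pi> x = \<pi> w}"
  then have "x \<in> pverts H" "w \<in> pverts H"
    using v vw reach_vertex shift_vertex by (auto simp: pverts_component_of)
  then obtain b where b: "x = shift b w"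
    using fibre[of w x] x by auto
  then have "b - a \<in> holonomy v"
    using x reach_shift_shift[OF vw] by (simp add: pverts_component_of)
  then show "x \<in> (\<lambda>h. shift (a + h) w) ` holonomy v"
    using b by (auto intro!: image_eqI[of _ _ "b - a"])
qed (auto simp: pverts_component_of reach_shift_shift[OF vw] proj_shift)

text \<open>
Two displacements of \<open>v\<close> lie in the same component if and only if they are congruent modulo the
holonomy, so choosing one displacement for each component gives a system of coset
representatives.
\<close>

lemma coset_labelling:
  "\<exists>g. \<forall>C \<in> range (\<lambda>a. component_of H (shift a v)). \<forall>a.
     a \<in> g C +o holonomy v \<longleftrightarrow> component_of H (shift a v) = C"
proof -
  have *: "a \<in> b +o holonomy v \<longleftrightarrow> component_of H (shift a v) = component_of H (shift b v)" for a b
  proof -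
    have "a \<in> b +o holonomy v \<longleftrightarrow> a - b \<in> holonomy v"
      by (force simp: elt_set_plus_def)
    also have "\<dots> \<longleftrightarrow> component_of H (shift b v) = component_of H (shift a v)"
      by (simp add: component_of_eq_iff[OF sym_cover] reach_shift_shift)
    finally show ?thesis by auto
  qed
  have "\<exists>b. \<forall>a. a \<in> b +o holonomy v \<longleftrightarrow> component_of H (shift a v) = C"
    if "C \<in> range (\<lambda>a. component_of H (shift a v))" for C
    using that * by auto
  then show ?thesis by metis
qed

end

section \<open>The projection as a regular covering\<close>

text \<open>
The right-hand side of the adjacency equation indexed by a nonempty sequence \<open>\<alpha>\<close>. It involves only
entries indexed by \<open>*\<close> and by a proper prefix of \<open>\<alpha>\<close>.
\<close>

definition cross_term :: "bitseq \<Rightarrow> (bitseq option \<Rightarrow> 'a::field) \<Rightarrow> (bitseq option \<Rightarrow> 'a) \<Rightarrow> 'a" where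
  "cross_term \<alpha> l r =
     (if last \<alpha> then l None * r (Some (butlast \<alpha>)) else r None * l (Some (butlast \<alpha>)))"

text \<open>
The opposite signs on the two sides keep \<open>l\<^sub>\<alpha> + r\<^sub>\<alpha>\<close> fixed, and hence adjacency when \<open>\<alpha>\<close> is maximal.
\<close>

definition shift_vec :: "bitseq \<Rightarrow> 'a::field \<Rightarrow> 'a vertex \<Rightarrow> 'a vertex" where
  "shift_vec \<alpha> a v = (case v of
       LVec l \<Rightarrow> LVec (l(Some \<alpha> := l (Some \<alpha>) + a))
     | RVec r \<Rightarrow> RVec (r(Some \<alpha> := r (Some \<alpha>) - a)))"

text \<open>
Every entry in an adjacency equation is indexed by \<open>*\<close>, an element of \<open>\<Omega>\<close> or, by condition C1, the
predecessor of an element of \<open>\<Omega>\<close>, which again lies in \<open>\<Omega>\<close>.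
\<close>

lemma adjacent_cong:
  assumes "C1 \<Omega>" and "\<And>i. i \<in> index \<Omega> \<Longrightarrow> l i = l' i" and "\<And>i. i \<in> index \<Omega> \<Longrightarrow> r i = r' i"
  shows "adjacent \<Omega> l r \<longleftrightarrow> adjacent \<Omega> l' r'"
proof -
  have "[] \<in> \<Omega>" and prefix: "\<gamma> @ [b] \<in> \<Omega> \<Longrightarrow> \<gamma> \<in> \<Omega>" for \<gamma> b
    using assms(1) by (auto simp: C1_def dest: bspec[of _ _ "\<gamma> @ [b]"])
  have "l None = l' None" "r None = r' None"
    and "\<And>\<gamma>. \<gamma> \<in> \<Omega> \<Longrightarrow> l (Some \<gamma>) = l' (Some \<gamma>)" "\<And>\<gamma>. \<gamma> \<in> \<Omega> \<Longrightarrow> r (Some \<gamma>) = r' (Some \<gamma>)"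
    using assms(2,3) by (auto simp: index_def)
  then show ?thesis
    unfolding adjacent_def using \<open>[] \<in> \<Omega>\<close> prefix by (intro conj_cong all_cong imp_cong) auto
qed

lemma adjacent_split:
  assumes "\<alpha> \<in> \<Omega>" and "\<alpha> \<noteq> []"
  shows "adjacent \<Omega> l r \<longleftrightarrow>
    adjacent (\<Omega> - {\<alpha>}) l r \<and> l (Some \<alpha>) + r (Some \<alpha>) = cross_term \<alpha> l r"
proof -
  obtain \<beta> b where \<alpha>: "\<alpha> = \<beta> @ [b]"
    using assms(2) by (metis append_butlast_last_id)
  show ?thesis
    using assms(1) unfolding adjacent_def cross_term_def \<alpha> by (cases b) auto
qed

lemma Gam_simps:
  "pverts (Gam \<Omega>) = left_vertices \<Omega> \<union> right_vertices \<Omega>"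
  "LVec l \<in> left_vertices \<Omega> \<longleftrightarrow> l \<in> index \<Omega> \<rightarrow>\<^sub>E UNIV"
  "RVec l \<in> right_vertices \<Omega> \<longleftrightarrow> l \<in> index \<Omega> \<rightarrow>\<^sub>E UNIV"
  "LVec l \<notin> right_vertices \<Omega>"
  "RVec l \<notin> left_vertices \<Omega>"
  by (auto simp: Gam_def Let_def left_vertices_def right_vertices_def)

lemma parcs_Gam:
  "(LVec l, LVec m) \<notin> parcs (Gam \<Omega>)"
  "(RVec l, RVec m) \<notin> parcs (Gam \<Omega>)"
  "(LVec l, RVec r) \<in> parcs (Gam \<Omega>) \<longleftrightarrow>
     l \<in> index \<Omega> \<rightarrow>\<^sub>E UNIV \<and> r \<in> index \<Omega> \<rightarrow>\<^sub>E UNIV \<and> adjacent \<Omega> l r"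
  "(RVec r, LVec l) \<in> parcs (Gam \<Omega>) \<longleftrightarrow>
     l \<in> index \<Omega> \<rightarrow>\<^sub>E UNIV \<and> r \<in> index \<Omega> \<rightarrow>\<^sub>E UNIV \<and> adjacent \<Omega> l r"
  by (auto simp: Gam_def Let_def left_vertices_def right_vertices_def)

lemma sym_Gam: "sym (parcs (Gam \<Omega>))"
  by (auto simp: Gam_def Let_def sym_Un_converse)

lemma wf_Gam: "parcs (Gam \<Omega>) \<subseteq> pverts (Gam \<Omega>) \<times> pverts (Gam \<Omega>)"
  by (auto simp: Gam_def Let_def)

text \<open>
Arcs come in opposite pairs, so whether a map preserves arcs needs to be checked only for those that
start on the left.
\<close>

lemma parcs_Gam_map:
  assumes LR: "\<And>l r. l \<in> index \<Omega> \<rightarrow>\<^sub>E UNIV \<Longrightarrow> r \<in> index \<Omega> \<rightarrow>\<^sub>E UNIV \<Longrightarrow> adjacent \<Omega> l r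
           \<Longrightarrow> (f (LVec l), f (RVec r)) \<in> parcs (Gam \<Omega>')"
    and "(v, w) \<in> parcs (Gam \<Omega>)"
  shows "(f v, f w) \<in> parcs (Gam \<Omega>')"
  using assms(2) LR symD[OF sym_Gam[of \<Omega>']]
  by (cases v; cases w) (auto simp: parcs_Gam)

text \<open>
As \<open>\<Omega> - {\<alpha>}\<close> satisfies C1, the sequence \<open>\<alpha>\<close> is nonempty and no element of \<open>\<Omega>\<close> extends it by a bit. So
the entry \<open>\<alpha>\<close> occurs in a single adjacency equation, \<open>l\<^sub>\<alpha> + r\<^sub>\<alpha> = h\<close>, where \<open>h\<close> depends only on the
remaining entries. Given an arc of the smaller graph and the entry \<open>\<alpha>\<close> at one end, the equation
determines the entry \<open>\<alpha>\<close> at the other end, so arcs lift; and it is invariant under adding \<open>a\<close> to \<open>l\<^sub>\<alpha>\<close>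
while subtracting \<open>a\<close> from \<open>r\<^sub>\<alpha>\<close>.
\<close>

lemma regular_cover_Gam:
  assumes "C1 \<Omega>" and "\<alpha> \<in> \<Omega>" and "C1 (\<Omega> - {\<alpha>})"
  shows "regular_cover (Gam \<Omega>) (Gam (\<Omega> - {\<alpha>})) (proj (\<Omega> - {\<alpha>})) (shift_vec \<alpha>)"
proof -
  let ?\<Omega>' = "\<Omega> - {\<alpha>}"
  let ?I = "index ?\<Omega>'"
  have \<alpha>: "\<alpha> \<in> \<Omega>" "\<alpha> \<noteq> []"
    using assms by (auto simp: C1_def)
  have I: "index \<Omega> = insert (Some \<alpha>) ?I" "Some \<alpha> \<notin> ?I"
    using \<alpha> by (auto simp: index_def)
  have "butlast \<alpha> \<in> \<Omega>" "butlast \<alpha> \<noteq> \<alpha>"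
    using \<open>C1 \<Omega>\<close> \<alpha> by (auto simp: C1_def) (metis append_butlast_last_id not_Cons_self2 append_self_conv)
  then have I': "None \<in> ?I" "Some (butlast \<alpha>) \<in> ?I"
    by (auto simp: index_def)
  have cong: "adjacent ?\<Omega>' l r = adjacent ?\<Omega>' l' r' \<and> cross_term \<alpha> l r = cross_term \<alpha> l' r'"
    if "\<And>i. i \<in> ?I \<Longrightarrow> l i = l' i" "\<And>i. i \<in> ?I \<Longrightarrow> r i = r' i" for l r l' r' :: "bitseq option \<Rightarrow> 'a"
    using adjacent_cong[OF assms(3), of l l' r r'] that I' by (simp add: cross_term_def)
  have adj: "adjacent \<Omega> l r \<longleftrightarrow> adjacent ?\<Omega>' l' r' \<and> l (Some \<alpha>) + r (Some \<alpha>) = cross_term \<alpha> l' r'"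
    if "\<And>i. i \<in> ?I \<Longrightarrow> l i = l' i" "\<And>i. i \<in> ?I \<Longrightarrow> r i = r' i" for l r l' r' :: "bitseq option \<Rightarrow> 'a"
    using adjacent_split[OF \<alpha>, of l r] cong[OF that] by simp
  have ext_cover: "l \<in> index \<Omega> \<rightarrow>\<^sub>E UNIV \<longleftrightarrow> (\<forall>i. i \<notin> ?I \<longrightarrow> i \<noteq> Some \<alpha> \<longrightarrow> l i = undefined)" for l :: "bitseq option \<Rightarrow> 'a"
    unfolding I by (auto simp: PiE_def extensional_def)
  have ext_base: "l \<in> ?I \<rightarrow>\<^sub>E UNIV \<longleftrightarrow> (\<forall>i. i \<notin> ?I \<longrightarrow> l i = undefined)" for l :: "bitseq option \<Rightarrow> 'a"
    by (auto simp: PiE_def extensional_def)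
  have upd: "l(Some \<alpha> := c) \<in> index \<Omega> \<rightarrow>\<^sub>E UNIV" "restrict (l(Some \<alpha> := c)) ?I = restrict l ?I"
    if "l \<in> index \<Omega> \<rightarrow>\<^sub>E UNIV \<or> l \<in> ?I \<rightarrow>\<^sub>E UNIV" for l :: "bitseq option \<Rightarrow> 'a" and c
    using that I(2) by (auto simp: ext_cover ext_base restrict_def)
  have res: "restrict l ?I = l" if "l \<in> ?I \<rightarrow>\<^sub>E UNIV" for l :: "bitseq option \<Rightarrow> 'a"
    using that by (rule PiE_restrict)
  have fib: "\<exists>a. l' = l(Some \<alpha> := l (Some \<alpha>) + a)"
    if "l \<in> index \<Omega> \<rightarrow>\<^sub>E UNIV" "l' \<in> index \<Omega> \<rightarrow>\<^sub>E UNIV" "restrict l ?I = restrict l' ?I"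
    for l l' :: "bitseq option \<Rightarrow> 'a"
  proof -
    have "l i = l' i" if "i \<in> ?I" for i
      using \<open>restrict l ?I = restrict l' ?I\<close> that by (metis restrict_apply')
    then have "l' i = (l(Some \<alpha> := l (Some \<alpha>) + (l' (Some \<alpha>) - l (Some \<alpha>)))) i" for i
      using that(1,2) by (cases "i \<in> ?I"; cases "i = Some \<alpha>") (auto simp: ext_cover)
    then have "l' = l(Some \<alpha> := l (Some \<alpha>) + (l' (Some \<alpha>) - l (Some \<alpha>)))"
      by blast
    then show ?thesis ..
  qed
  show ?thesis
  proof
    show "(proj ?\<Omega>' v, proj ?\<Omega>' w) \<in> parcs (Gam ?\<Omega>')"
      if "(v, w) \<in> parcs (Gam \<Omega>)" for v w :: "'a vertex"
      by (rule parcs_Gam_map[OF _ that]) (auto simp: proj_def parcs_Gam adj[of _ "restrict _ ?I" _ "restrict _ ?I"])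
    show "(shift_vec \<alpha> a v, shift_vec \<alpha> a w) \<in> parcs (Gam \<Omega>)"
      if "(v, w) \<in> parcs (Gam \<Omega>)" for v w and a :: 'a
    proof (rule parcs_Gam_map[OF _ that])
      fix l r :: "bitseq option \<Rightarrow> 'a"
      assume lr: "l \<in> index \<Omega> \<rightarrow>\<^sub>E UNIV" "r \<in> index \<Omega> \<rightarrow>\<^sub>E UNIV" "adjacent \<Omega> l r"
      then have "adjacent \<Omega> (l(Some \<alpha> := l (Some \<alpha>) + a)) (r(Some \<alpha> := r (Some \<alpha>) - a))"
        using I(2) adj[of l l r r] by (subst adj[of _ l _ r]) auto
      then show "(shift_vec \<alpha> a (LVec l), shift_vec \<alpha> a (RVec r)) \<in> parcs (Gam \<Omega>)"
        using lr upd by (simp add: shift_vec_def parcs_Gam)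
    qed
    show "\<exists>w. (v, w) \<in> parcs (Gam \<Omega>) \<and> proj ?\<Omega>' w = u"
      if v: "v \<in> pverts (Gam \<Omega>)" and arc: "(proj ?\<Omega>' v, u) \<in> parcs (Gam ?\<Omega>')" for v u :: "'a vertex"
    proof (cases v)
      case (LVec l)
      then obtain r where u: "u = RVec r" and r: "r \<in> ?I \<rightarrow>\<^sub>E UNIV" and lr: "adjacent ?\<Omega>' (restrict l ?I) r"
        using arc by (cases u) (auto simp: proj_def parcs_Gam)
      let ?r = "r(Some \<alpha> := cross_term \<alpha> l r - l (Some \<alpha>))"
      have "adjacent \<Omega> l ?r"
        using I(2) lr cong[of l "restrict l ?I" r r] by (subst adj[of _ l _ r]) auto
      then have "(v, RVec ?r) \<in> parcs (Gam \<Omega>)" "proj ?\<Omega>' (RVec ?r) = u"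
        using v LVec upd[of r] r res[OF r] by (auto simp: parcs_Gam Gam_simps proj_def u)
      then show ?thesis by blast
    next
      case (RVec r)
      then obtain l where u: "u = LVec l" and l: "l \<in> ?I \<rightarrow>\<^sub>E UNIV" and lr: "adjacent ?\<Omega>' l (restrict r ?I)"
        using arc by (cases u) (auto simp: proj_def parcs_Gam)
      let ?l = "l(Some \<alpha> := cross_term \<alpha> l r - r (Some \<alpha>))"
      have "adjacent \<Omega> ?l r"
        using I(2) lr cong[of l l r "restrict r ?I"] by (subst adj[of _ l _ r]) auto
      then have "(v, LVec ?l) \<in> parcs (Gam \<Omega>)" "proj ?\<Omega>' (LVec ?l) = u"
        using v RVec upd[of l] l res[OF l] by (auto simp: parcs_Gam Gam_simps proj_def u)
      then show ?thesis by blast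
    qed
    show "\<exists>v\<in>pverts (Gam \<Omega>). proj ?\<Omega>' v = u" if "u \<in> pverts (Gam ?\<Omega>')" for u :: "'a vertex"
    proof (cases u)
      case (LVec l)
      then have "l \<in> ?I \<rightarrow>\<^sub>E UNIV" using that by (auto simp: Gam_simps)
      with LVec show ?thesis
        using upd[of l 0] res[of l] by (intro bexI[of _ "LVec (l(Some \<alpha> := 0))"]) (auto simp: proj_def Gam_simps)
    next
      case (RVec l)
      then have "l \<in> ?I \<rightarrow>\<^sub>E UNIV" using that by (auto simp: Gam_simps)
      with RVec show ?thesis
        using upd[of l 0] res[of l] by (intro bexI[of _ "RVec (l(Some \<alpha> := 0))"]) (auto simp: proj_def Gam_simps)
    qed
    show "shift_vec \<alpha> a v \<in> pverts (Gam \<Omega>)" if "v \<in> pverts (Gam \<Omega>)" for v and a :: 'a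
      using that upd by (cases v) (auto simp: shift_vec_def Gam_simps)
    show "proj ?\<Omega>' (shift_vec \<alpha> a v) = proj ?\<Omega>' v" for v and a :: 'a
      using I(2) by (cases v) (auto simp: shift_vec_def proj_def restrict_def)
    show "\<exists>a. w = shift_vec \<alpha> a v"
      if vw: "v \<in> pverts (Gam \<Omega>)" "w \<in> pverts (Gam \<Omega>)" "proj ?\<Omega>' v = proj ?\<Omega>' w" for v w :: "'a vertex"
    proof (cases v)
      case (LVec l)
      then show ?thesis
        using vw fib[of l] by (cases w) (auto simp: Gam_simps proj_def shift_vec_def)
    next
      case (RVec r)
      then obtain r' where "w = RVec r'" "\<exists>a. r' = r(Some \<alpha> := r (Some \<alpha>) + a)"
        using vw fib[of r] by (cases w) (auto simp: Gam_simps proj_def)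
      then show ?thesis
        using RVec by (auto simp: shift_vec_def intro: exI[of _ "- _"])
    qed
    show "shift_vec \<alpha> 0 v = v" for v :: "'a vertex"
      by (cases v) (auto simp: shift_vec_def)
    show "shift_vec \<alpha> (a + b) v = shift_vec \<alpha> a (shift_vec \<alpha> b v)" for v and a b :: 'a
      by (cases v) (auto simp: shift_vec_def algebra_simps)
  qed (fact sym_Gam wf_Gam)+
qed

section \<open>Torus symmetries\<close>

text \<open>
Scaling \<open>l\<^sub>*\<close> by \<open>a\<close> and \<open>r\<^sub>*\<close> by \<open>b\<close> extends to a symmetry of the graph. The equation for the empty
sequence forces the factor \<open>a b\<close> there, each further bit \<open>0\<close> contributes another factor \<open>b\<close> and each bit
\<open>1\<close> another factor \<open>a\<close>.
\<close>

definition torus_factor :: "'a::field \<Rightarrow> 'a \<Rightarrow> bitseq \<Rightarrow> 'a" where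
  "torus_factor a b \<gamma> = a ^ (weight \<gamma> + 1) * b ^ (length \<gamma> - weight \<gamma> + 1)"

definition torus_act :: "bitseq set \<Rightarrow> 'a::field \<Rightarrow> 'a \<Rightarrow> 'a vertex \<Rightarrow> 'a vertex" where
  "torus_act \<Omega> a b v = (case v of
       LVec l \<Rightarrow> LVec (\<lambda>i\<in>index \<Omega>. (case i of None \<Rightarrow> a | Some \<gamma> \<Rightarrow> torus_factor a b \<gamma>) * l i)
     | RVec r \<Rightarrow> RVec (\<lambda>i\<in>index \<Omega>. (case i of None \<Rightarrow> b | Some \<gamma> \<Rightarrow> torus_factor a b \<gamma>) * r i))"

lemma torus_factor_simps:
  "torus_factor a b [] = a * b"
  "torus_factor a b (\<gamma> @ [False]) = b * torus_factor a b \<gamma>"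
  "torus_factor a b (\<gamma> @ [True]) = a * torus_factor a b \<gamma>"
proof -
  have "weight \<gamma> \<le> length \<gamma>"
    by (simp add: weight_def count_le_length)
  then show "torus_factor a b (\<gamma> @ [False]) = b * torus_factor a b \<gamma>"
    by (simp add: torus_factor_def weight_def Suc_diff_le)
qed (simp_all add: torus_factor_def weight_def)

lemma torus_act_arc:
  assumes "C1 \<Omega>" and "(v, w) \<in> parcs (Gam \<Omega>)"
  shows "(torus_act \<Omega> a b v, torus_act \<Omega> a b w) \<in> parcs (Gam \<Omega>)"
proof (rule parcs_Gam_map[OF _ assms(2)])
  fix l r :: "bitseq option \<Rightarrow> 'a"
  assume "adjacent \<Omega> l r"
  let ?l = "\<lambda>i. (case i of None \<Rightarrow> a | Some \<gamma> \<Rightarrow> torus_factor a b \<gamma>) * l i"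
  let ?r = "\<lambda>i. (case i of None \<Rightarrow> b | Some \<gamma> \<Rightarrow> torus_factor a b \<gamma>) * r i"
  have "adjacent \<Omega> ?l ?r"
    using \<open>adjacent \<Omega> l r\<close> unfolding adjacent_def
    by (auto simp: torus_factor_simps simp flip: distrib_left)
  then have "adjacent \<Omega> (restrict ?l (index \<Omega>)) (restrict ?r (index \<Omega>))"
    by (subst adjacent_cong[OF assms(1), of _ ?l _ ?r]) auto
  then show "(torus_act \<Omega> a b (LVec l), torus_act \<Omega> a b (RVec r)) \<in> parcs (Gam \<Omega>)"
    by (simp add: torus_act_def parcs_Gam)
qed

text \<open>
By Bezout the greatest common divisor is a combination of the two exponents of the torus factor
modulo \<open>q - 1\<close>, and \<open>x\<^sup>q\<^sup>-\<^sup>1 = 1\<close>. The negative coefficient is realized by taking \<open>b\<close> to be a power of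
the inverse of \<open>x\<close>.
\<close>

lemma power_eq_torus_factor:
  fixes x :: "'a::{field,finite}"
  assumes "x \<noteq> 0"
  shows "\<exists>a b. torus_factor a b \<gamma> =
    x ^ gcd (CARD('a) - 1) (gcd (weight \<gamma> + 1) (length \<gamma> - weight \<gamma> + 1))"
proof -
  let ?Q = "CARD('a) - 1" and ?u = "weight \<gamma> + 1" and ?v = "length \<gamma> - weight \<gamma> + 1"
  have x1: "x ^ (?Q * k) = 1" for k
    using power_card_minus_one_eq_1[OF assms] by (simp add: power_mult)
  obtain i j where ij: "?u * i = ?v * j + gcd ?u ?v"
    using bezout_nat[of ?u ?v] by auto
  obtain k m where km: "gcd ?u ?v * k = ?Q * m + gcd ?Q (gcd ?u ?v)"
    using bezout_nat[of "gcd ?u ?v" ?Q] by (auto simp: gcd.commute)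
  have "x ^ (?u * (i * k)) = x ^ (?v * (j * k)) * x ^ (gcd ?u ?v * k)"
    unfolding mult.assoc[symmetric] ij by (simp add: algebra_simps flip: power_add)
  moreover have "x ^ (gcd ?u ?v * k) = x ^ gcd ?Q (gcd ?u ?v)"
    unfolding km power_add x1 by simp
  ultimately have "x ^ (?u * (i * k)) * inverse (x ^ (?v * (j * k))) = x ^ gcd ?Q (gcd ?u ?v)"
    using assms by simp
  moreover have "torus_factor (x ^ (i * k)) (inverse (x ^ (j * k))) \<gamma>
      = x ^ (?u * (i * k)) * inverse (x ^ (?v * (j * k)))"
    by (simp only: torus_factor_def power_inverse mult.commute[of ?u] mult.commute[of ?v] power_mult)
  ultimately have "torus_factor (x ^ (i * k)) (inverse (x ^ (j * k))) \<gamma> = x ^ gcd ?Q (gcd ?u ?v)"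
    by (rule trans[rotated])
  then show ?thesis by blast
qed

text \<open>
Torus symmetries fix the zero vertex and multiply its displacements by the torus factor of \<open>\<alpha>\<close>, so
they carry a walk from the zero vertex to its displacement by \<open>y\<close> to one that ends at the
displacement by the scaled \<open>y\<close>.
\<close>

lemma holonomy_zero_invariant:
  assumes "C1 \<Omega>" and "\<alpha> \<in> \<Omega>" and "C1 (\<Omega> - {\<alpha>})"
    and y: "y \<in> regular_cover.holonomy (Gam \<Omega>) (shift_vec \<alpha>) (LVec (zero_vec \<Omega>))"
  shows "torus_factor a b \<alpha> * y
    \<in> regular_cover.holonomy (Gam \<Omega>) (shift_vec \<alpha>) (LVec (zero_vec \<Omega>))"
proof -
  interpret regular_cover "Gam \<Omega>" "Gam (\<Omega> - {\<alpha>})" "proj (\<Omega> - {\<alpha>})" "shift_vec \<alpha>"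
    by (rule regular_cover_Gam) fact+
  let ?o = "LVec (zero_vec \<Omega>) :: 'a vertex"
  have "Some \<alpha> \<in> index \<Omega>"
    using assms(2) by (simp add: index_def)
  then have act: "torus_act \<Omega> a b (shift_vec \<alpha> y ?o) = shift_vec \<alpha> (torus_factor a b \<alpha> * y) ?o" for y
    by (auto simp: torus_act_def shift_vec_def zero_vec_def)
  have "(torus_act \<Omega> a b v, torus_act \<Omega> a b w) \<in> (parcs (Gam \<Omega>))\<^sup>*"
    if "(v, w) \<in> (parcs (Gam \<Omega>))\<^sup>*" for v w
    using that by induction (auto intro: torus_act_arc[OF assms(1)] rtrancl_into_rtrancl)
  from this[of ?o "shift_vec \<alpha> y ?o"] show ?thesis
    using y act[of 0] act[of y] by (simp add: holonomy_def shift_0)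
qed

section \<open>Fibres of the components\<close>

theorem theorem6:
  fixes \<Omega> \<Omega>' :: "bitseq set" and \<alpha> :: bitseq
    and C' :: "'a::{field,finite} vertex pair_pre_digraph"
    and q p s t n :: nat
  assumes "finite \<Omega>" and "C1 \<Omega>"
    and "maximal_in \<alpha> \<Omega>"
    and "\<Omega>' = \<Omega> - {\<alpha>}" and "C1 \<Omega>'"
    and "C' \<in> components (Gam \<Omega>')"
    and "q = CARD('a)" and "p = CHAR('a)"
    and "s = card (lifts \<Omega> \<Omega>' C')" and "t = q div s"
    and "n = (LEAST k. k > 0 \<and>
           q - 1 dvd (p ^ k - 1) *
             gcd (q - 1) (gcd (weight \<alpha> + 1) (length \<alpha> - weight \<alpha> + 1)))"
  shows "s dvd q \<and>
    (\<exists>(f :: 'a vertex \<Rightarrow> 'a) (g :: 'a vertex pair_pre_digraph \<Rightarrow> 'a) (G :: 'a set).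
       additive_subgroup G \<and> card G = t \<and>
       (\<forall>C\<in>lifts \<Omega> \<Omega>' C'. \<forall>u'\<in>pverts C'.
          (u' \<in> left_vertices \<Omega>' \<longrightarrow> rho \<Omega>' \<alpha> u' C = (f u' + g C) +o G) \<and>
          (u' \<in> right_vertices \<Omega>' \<longrightarrow> rho \<Omega>' \<alpha> u' C = (f u' - g C) +o G)) \<and>
       inj_on (\<lambda>C. g C +o G) (lifts \<Omega> \<Omega>' C') \<and>
       (\<Union>C\<in>lifts \<Omega> \<Omega>' C'. g C +o G) = UNIV \<and>
       (LVec (zero_vec \<Omega>') \<in> pverts C' \<and> RVec (zero_vec \<Omega>') \<in> pverts C' \<longrightarrow>
          (\<exists>m::nat. real m \<le> log (real (p ^ n)) (real q) \<and> t = p ^ (m * n))))"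
proof -
  have "\<alpha> \<in> \<Omega>"
    using \<open>maximal_in \<alpha> \<Omega>\<close> by (simp add: maximal_in_def)
  note hyps = \<open>C1 \<Omega>\<close> \<open>\<alpha> \<in> \<Omega>\<close> \<open>C1 \<Omega>'\<close>[unfolded \<open>\<Omega>' = \<Omega> - {\<alpha>}\<close>]
  interpret regular_cover "Gam \<Omega> :: 'a vertex pair_pre_digraph" "Gam \<Omega>'" "proj \<Omega>'" "shift_vec \<alpha>"
    unfolding \<open>\<Omega>' = \<Omega> - {\<alpha>}\<close> by (rule regular_cover_Gam[OF hyps])
  let ?H = "Gam \<Omega> :: 'a vertex pair_pre_digraph" and ?H' = "Gam \<Omega>' :: 'a vertex pair_pre_digraph"

  \<comment> \<open>The base vertex is arbitrary, except that it is the zero vertex if that is available, so that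
    the torus symmetries fix it.\<close>
  obtain v where v: "v \<in> pverts ?H" and C': "C' = component_of ?H' (proj \<Omega>' v)"
    and v_zero: "LVec (zero_vec \<Omega>') \<in> pverts C' \<Longrightarrow> v = LVec (zero_vec \<Omega>)"
  proof -
    obtain u where u: "u \<in> pverts ?H'" "C' = component_of ?H' u"
      using \<open>C' \<in> components (Gam \<Omega>')\<close> by (auto simp: components_eq_component_of[OF sym_base wf_base])
    show thesis
    proof (cases "LVec (zero_vec \<Omega>') \<in> pverts C'")
      case True
      have "LVec (zero_vec \<Omega>) \<in> pverts ?H"
        by (auto simp: Gam_simps zero_vec_def)
      moreover have "index \<Omega>' \<subseteq> index \<Omega>"
        using \<open>\<Omega>' = \<Omega> - {\<alpha>}\<close> by (auto simp: index_def)
      then have "proj \<Omega>' (LVec (zero_vec \<Omega>)) = (LVec (zero_vec \<Omega>') :: 'a vertex)"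
        by (auto simp: proj_def zero_vec_def restrict_def fun_eq_iff)
      moreover have "C' = component_of ?H' (LVec (zero_vec \<Omega>'))"
        using True u component_of_eq_iff[OF sym_base] by (auto simp: pverts_component_of)
      ultimately show thesis
        using that by auto
    qed (use that lift_vertex u in blast)
  qed
  have lifts: "lifts \<Omega> \<Omega>' C' = range (\<lambda>a. component_of ?H (shift_vec \<alpha> a v))"
    unfolding lifts_def proj_graph_def C' by (rule components_over[OF v])
  define G where "G = holonomy v"
  have G: "additive_subgroup G"
    unfolding G_def by (rule additive_subgroup_holonomy)
  obtain g where g: "\<And>C a. C \<in> lifts \<Omega> \<Omega>' C' \<Longrightarrow>
      a \<in> g C +o G \<longleftrightarrow> component_of ?H (shift_vec \<alpha> a v) = C"
    using coset_labelling[of v] unfolding lifts G_def by metis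
  have g_self: "component_of ?H (shift_vec \<alpha> (g C) v) = C" if "C \<in> lifts \<Omega> \<Omega>' C'" for C
    using g[OF that, of "g C"] G by (force simp: additive_subgroup_def elt_set_plus_def)
  have disj: "(g C +o G) \<inter> (g D +o G) = {}" if "C \<in> lifts \<Omega> \<Omega>' C'" "D \<in> lifts \<Omega> \<Omega>' C'" "C \<noteq> D" for C D
    using that g by auto
  have union: "(\<Union>C\<in>lifts \<Omega> \<Omega>' C'. g C +o G) = UNIV"
  proof -
    have "a \<in> (\<Union>C\<in>lifts \<Omega> \<Omega>' C'. g C +o G)" for a
      using g[of "component_of ?H (shift_vec \<alpha> a v)" a] lifts by auto
    then show ?thesis by blast
  qed
  have inj: "inj_on (\<lambda>C. g C +o G) (lifts \<Omega> \<Omega>' C')"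
  proof (rule inj_onI)
    fix C D assume CD: "C \<in> lifts \<Omega> \<Omega>' C'" "D \<in> lifts \<Omega> \<Omega>' C'" "g C +o G = g D +o G"
    then show "C = D"
      using g[of C "g C"] g[of D "g C"] g_self[of C] by auto
  qed

  have "finite (lifts \<Omega> \<Omega>' C')"
    unfolding lifts by simp
  have q: "q = s * card G"
  proof -
    have "card (x +o G) = card G" for x
    proof -
      have "x +o G = (+) x ` G" by (auto simp: elt_set_plus_def)
      then show ?thesis by (simp add: card_image)
    qed
    moreover have "card (\<Union>C\<in>lifts \<Omega> \<Omega>' C'. g C +o G) = (\<Sum>C\<in>lifts \<Omega> \<Omega>' C'. card (g C +o G))"
      using \<open>finite (lifts \<Omega> \<Omega>' C')\<close> disj by (intro card_UN_disjoint) auto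
    ultimately show ?thesis
      using union \<open>q = CARD('a)\<close> \<open>s = card (lifts \<Omega> \<Omega>' C')\<close> by simp
  qed
  moreover have "q > 0"
    using \<open>q = CARD('a)\<close> by simp
  ultimately have card_G: "card G = t" and "s dvd q"
    using \<open>t = q div s\<close> by auto

  \<comment> \<open>\<open>F u\<close> is the end point of a lift, starting at \<open>v\<close>, of a walk from the base point to \<open>u\<close>.\<close>
  have "\<exists>w. (v, w) \<in> (parcs ?H)\<^sup>* \<and> proj \<Omega>' w = u" if "u \<in> pverts C'" for u
    using that lift_reach[OF _ v] by (simp add: C' pverts_component_of)
  then obtain F where F: "\<And>u. u \<in> pverts C' \<Longrightarrow> (v, F u) \<in> (parcs ?H)\<^sup>*"
    "\<And>u. u \<in> pverts C' \<Longrightarrow> proj \<Omega>' (F u) = u"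
    by metis
  define f where "f u = entry (F u) (Some \<alpha>)" for u
  have rho: "rho \<Omega>' \<alpha> u C = (\<lambda>h. entry (shift_vec \<alpha> (g C + h) (F u)) (Some \<alpha>)) ` G"
    if "C \<in> lifts \<Omega> \<Omega>' C'" "u \<in> pverts C'" for C u
  proof -
    have "rho \<Omega>' \<alpha> u C = (\<lambda>x. entry x (Some \<alpha>)) ` {x \<in> pverts C. proj \<Omega>' x = proj \<Omega>' (F u)}"
      using F(2)[OF that(2)] by (auto simp: rho_def)
    also have "{x \<in> pverts C. proj \<Omega>' x = proj \<Omega>' (F u)} = (\<lambda>h. shift_vec \<alpha> (g C + h) (F u)) ` G"
      using component_fibre[OF v F(1)[OF that(2)], of "g C"] g_self[OF that(1)] by (simp add: G_def)
    finally show ?thesis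
      by (simp add: image_image)
  qed
  have rho_left: "rho \<Omega>' \<alpha> u C = (f u + g C) +o G"
    if Cu: "C \<in> lifts \<Omega> \<Omega>' C'" "u \<in> pverts C'" "u \<in> left_vertices \<Omega>'" for C u
  proof -
    obtain l where "F u = LVec l"
      using F(2)[OF Cu(2)] Cu(3) by (cases "F u") (auto simp: proj_def Gam_simps)
    then show ?thesis
      using rho[OF Cu(1,2)] by (auto simp: f_def shift_vec_def elt_set_plus_def add.assoc)
  qed
  have rho_right: "rho \<Omega>' \<alpha> u C = (f u - g C) +o G"
    if Cu: "C \<in> lifts \<Omega> \<Omega>' C'" "u \<in> pverts C'" "u \<in> right_vertices \<Omega>'" for C u
  proof -
    obtain r where "F u = RVec r"
      using F(2)[OF Cu(2)] Cu(3) by (cases "F u") (auto simp: proj_def Gam_simps)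
    \<comment> \<open>On this side displacements are subtracted, which reverses the sign of \<open>g C\<close> and replaces \<open>G\<close>
      by \<open>-G = G\<close>.\<close>
    then have "rho \<Omega>' \<alpha> u C = (\<lambda>h. f u - g C + h) ` uminus ` G"
      unfolding rho[OF Cu(1,2)] image_image by (simp add: f_def shift_vec_def algebra_simps)
    also have "uminus ` G = G"
      using G by (force simp: additive_subgroup_def intro: image_eqI[of _ _ "- _"])
    finally show ?thesis
      by (auto simp: elt_set_plus_def)
  qed

  have "\<exists>m. real m \<le> log (real (p ^ n)) (real q) \<and> t = p ^ (m * n)"
    if zero: "LVec (zero_vec \<Omega>') \<in> pverts C'"
  proof -
    let ?d = "gcd (q - 1) (gcd (weight \<alpha> + 1) (length \<alpha> - weight \<alpha> + 1))"
    have "x ^ ?d * y \<in> G" if "x \<noteq> 0" "y \<in> G" for x y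
    proof -
      obtain a b where "torus_factor a b \<alpha> = x ^ ?d"
        using power_eq_torus_factor[OF \<open>x \<noteq> 0\<close>, of \<alpha>] \<open>q = CARD('a)\<close> by auto
      then show ?thesis
        using holonomy_zero_invariant[OF hyps, of y a b] \<open>y \<in> G\<close> v_zero[OF zero] by (simp add: G_def)
    qed
    from card_power_invariant_subgroup[OF G this, of n]
    obtain m where n: "n > 0" and m: "t = p ^ (m * n)"
      using assms(7,8,11) card_G by auto
    have "prime p"
      using \<open>p = CHAR('a)\<close> by (simp add: prime_CHAR_semidom finite_imp_CHAR_pos)
    then have "1 < real (p ^ n)"
      using n by (simp add: one_less_power prime_gt_Suc_0_nat)
    moreover have "(p ^ n) ^ m \<le> q"
      using q card_G m \<open>q > 0\<close> by (auto simp: mult.commute simp flip: power_mult)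
    then have "real (p ^ n) ^ m \<le> real q"
      by (metis of_nat_le_iff of_nat_power)
    ultimately have "real m \<le> log (real (p ^ n)) (real q)"
      by (intro le_log_of_power) simp_all
    with m show ?thesis by blast
  qed
  then show ?thesis
    using \<open>s dvd q\<close> G card_G rho_left rho_right inj union by (intro conjI exI[of _ f] exI[of _ g] exI[of _ G]) auto
qed

end
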